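(* Let $d\ge 3$, $\mathcal A=\{0,1,\dots,d-1\}$, let $\varphi_d$ be the morphism $\varphi_d(i)=0(i+1)$ for $0\le i\le d-2$, $\varphi_d(d-1)=0(d-1)(d-1)$, and let $\mathbf u_d$ be its fixed point. Then every bispecial factor of $\mathbf u_d$ is ordinary.
   Context: The fixed point $\mathbf u_d$ is the unique infinite word starting with $0$ with $\varphi_d(\mathbf u_d)=\mathbf u_d$; $\mathcal L(\mathbf u_d)$ denotes its set of finite factors. For a factor $w$, $\mathrm{Lext}(w)=\{iw\in\mathcal L(\mathbf u_d): i\in\mathcal A\}$, $\mathrm{Rext}(w)=\{wi\in\mathcal L(\mathbf u_d): i\in\mathcal A\}$, $\mathrm{Bext}(w)=\{iwj\in\mathcal L(\mathbf u_d): i,j\in\mathcal A\}$. The factor $w$ is left (right) special if $\#\mathrm{Lext}(w)\ge 2$ ($\#\mathrm{Rext}(w)\ge2$), and bispecial if it is both. The bilateral order is $\mathrm b(w)=\#\mathrm{Bext}(w)-\#\mathrm{Lext}(w)-\#\mathrm{Rext}(w)+1$, and a bispecial factor is ordinary if $\mathrm b(w)=0$. *)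

theory Defs
  imports Main "HOL-Library.Stream"
begin

text \<open>Finite words are lists, infinite words are streams.\<close>

definition factors :: "'a stream \<Rightarrow> 'a list set" where
  "factors u = {w. \<exists>p v. u = p @- w @- v}"

definition Lext :: "'a set \<Rightarrow> 'a stream \<Rightarrow> 'a list \<Rightarrow> 'a list set" where
  "Lext A u w = {i # w |i. i \<in> A \<and> i # w \<in> factors u}"

definition Rext :: "'a set \<Rightarrow> 'a stream \<Rightarrow> 'a list \<Rightarrow> 'a list set" where
  "Rext A u w = {w @ [i] |i. i \<in> A \<and> w @ [i] \<in> factors u}"

definition Bext :: "'a set \<Rightarrow> 'a stream \<Rightarrow> 'a list \<Rightarrow> 'a list set" where
  "Bext A u w = {i # w @ [j] |i j. i \<in> A \<and> j \<in> A \<and> i # w @ [j] \<in> factors u}"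

definition left_special :: "'a set \<Rightarrow> 'a stream \<Rightarrow> 'a list \<Rightarrow> bool" where
  "left_special A u w \<longleftrightarrow> w \<in> factors u \<and> card (Lext A u w) \<ge> 2"

definition right_special :: "'a set \<Rightarrow> 'a stream \<Rightarrow> 'a list \<Rightarrow> bool" where
  "right_special A u w \<longleftrightarrow> w \<in> factors u \<and> card (Rext A u w) \<ge> 2"

definition bispecial :: "'a set \<Rightarrow> 'a stream \<Rightarrow> 'a list \<Rightarrow> bool" where
  "bispecial A u w \<longleftrightarrow> left_special A u w \<and> right_special A u w"

definition bilateral_order :: "'a set \<Rightarrow> 'a stream \<Rightarrow> 'a list \<Rightarrow> int" where
  "bilateral_order A u w =
    int (card (Bext A u w)) - int (card (Lext A u w)) - int (card (Rext A u w)) + 1"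

definition ordinary :: "'a set \<Rightarrow> 'a stream \<Rightarrow> 'a list \<Rightarrow> bool" where
  "ordinary A u w \<longleftrightarrow> bilateral_order A u w = 0"

text \<open>The morphism on letters; only its values on \<open>{..<d}\<close> matter.\<close>

definition phi :: "nat \<Rightarrow> nat \<Rightarrow> nat list" where
  "phi d i = (if i = d - 1 then [0, d - 1, d - 1] else [0, i + 1])"

text \<open>
  Since all images of letters are nonempty, \<open>flat (smap (phi d) u)\<close> is the image of the
  infinite word \<open>u\<close> under the morphism.
\<close>

definition is_fixed_point :: "nat \<Rightarrow> nat stream \<Rightarrow> bool" where
  "is_fixed_point d u \<longleftrightarrow>
    u \<in> streams {..<d} \<and> shd u = 0 \<and> flat (smap (phi d) u) = u"

definition fixed_word :: "nat \<Rightarrow> nat stream" where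
  "fixed_word d = (THE u. is_fixed_point d u)"

text \<open>The description in \<^const>\<open>fixed_word\<close> is proper.\<close>

lemma phi_not_Nil: "phi d i \<noteq> []"
  by (simp add: phi_def)

lemma flat_shift_phi:
  "flat (smap (phi d) (w @- v)) = concat (map (phi d) w) @- flat (smap (phi d) v)"
  by (induction w) (simp_all add: flat_Stream phi_not_Nil)

definition phi_iter :: "nat \<Rightarrow> nat \<Rightarrow> nat list" where
  "phi_iter d n = ((\<lambda>w. concat (map (phi d) w)) ^^ n) [0]"

lemma phi_iter_0: "phi_iter d 0 = [0]"
  by (simp add: phi_iter_def)

lemma phi_iter_Suc: "phi_iter d (Suc n) = concat (map (phi d) (phi_iter d n))"
  by (simp add: phi_iter_def)

lemma length_concat_phi: "length (concat (map (phi d) w)) \<ge> 2 * length w"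
  by (induction w) (auto simp: phi_def)

lemma length_phi_iter: "length (phi_iter d n) > n"
proof (induction n)
  case 0
  show ?case by (simp add: phi_iter_0)
next
  case (Suc n)
  then show ?case
    using length_concat_phi[of "phi_iter d n" d] by (simp add: phi_iter_Suc)
qed

lemma phi_iter_extends_Suc: "\<exists>v. phi_iter d (Suc n) = phi_iter d n @ v"
proof (induction n)
  case 0
  show ?case by (simp add: phi_iter_0 phi_iter_Suc phi_def)
next
  case (Suc n)
  then obtain v where "phi_iter d (Suc n) = phi_iter d n @ v" by blast
  then have "phi_iter d (Suc (Suc n)) = phi_iter d (Suc n) @ concat (map (phi d) v)"
    by (metis phi_iter_Suc map_append concat_append)
  then show ?case by blast
qed

lemma phi_iter_extends: "m \<le> n \<Longrightarrow> \<exists>v. phi_iter d n = phi_iter d m @ v"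
proof (induction n rule: dec_induct)
  case base
  show ?case by simp
next
  case (step n)
  then show ?case using phi_iter_extends_Suc[of d n] by auto
qed

lemma phi_iter_nth:
  assumes "i < length (phi_iter d m)" "i < length (phi_iter d n)"
  shows "phi_iter d m ! i = phi_iter d n ! i"
proof (cases "m \<le> n")
  case True
  then show ?thesis using phi_iter_extends[of m n d] assms by (auto simp: nth_append)
next
  case False
  then show ?thesis using phi_iter_extends[of n m d] assms by (auto simp: nth_append)
qed

lemma set_phi_iter: "d \<ge> 1 \<Longrightarrow> set (phi_iter d n) \<subseteq> {..<d}"
proof (induction n)
  case 0
  then show ?case by (simp add: phi_iter_0)
next
  case (Suc n)
  have "set (phi d i) \<subseteq> {..<d}" if "i \<in> set (phi_iter d n)" for i
  proof -
    have "i < d" using Suc that by auto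
    then show ?thesis by (auto simp: phi_def)
  qed
  then show ?case by (auto simp: phi_iter_Suc)
qed

lemma fixed_prefix:
  assumes "shd u = 0" "flat (smap (phi d) u) = u"
  shows "\<exists>v. u = phi_iter d n @- v"
proof (induction n)
  case 0
  have "u = [0] @- stl u" using assms(1) by (metis shift.simps stream.collapse)
  then show ?case unfolding phi_iter_0 by blast
next
  case (Suc n)
  then obtain v where "u = phi_iter d n @- v" by blast
  then have "u = phi_iter d (Suc n) @- flat (smap (phi d) v)"
    using assms(2) by (metis flat_shift_phi phi_iter_Suc)
  then show ?case by blast
qed

lemma stream_eqI: "(\<And>n. u !! n = v !! n) \<Longrightarrow> u = v"
  by (metis ext stream_smap_nats)

lemma snth_of_prefix:
  assumes "u = phi_iter d (Suc n) @- v"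
  shows "u !! n = phi_iter d (Suc n) ! n"
  using assms length_phi_iter[of "Suc n" d] by (simp add: shift_snth_less)

lemma ex1_fixed_point:
  assumes "d \<ge> 1"
  shows "\<exists>!u. is_fixed_point d u"
proof (rule ex_ex1I)
  define u where "u = smap (\<lambda>n. phi_iter d (Suc n) ! n) nats"
  have u_nth: "u !! n = phi_iter d (Suc n) ! n" for n
    by (simp add: u_def)
  have lenS: "n < length (phi_iter d (Suc n))" for n
    using length_phi_iter[of "Suc n" d] by simp
  have prefix: "u = phi_iter d n @- sdrop (length (phi_iter d n)) u" for n
  proof -
    have "stake (length (phi_iter d n)) u = phi_iter d n"
      by (rule nth_equalityI) (auto simp: u_nth intro: phi_iter_nth lenS)
    then show ?thesis by (metis stake_sdrop)
  qed
  have "flat (smap (phi d) u) = u"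
  proof (rule stream_eqI)
    fix n
    have "flat (smap (phi d) u) = phi_iter d (Suc n) @-
        flat (smap (phi d) (sdrop (length (phi_iter d n)) u))"
      by (metis prefix flat_shift_phi phi_iter_Suc)
    then show "flat (smap (phi d) u) !! n = u !! n"
      using snth_of_prefix u_nth by metis
  qed
  moreover have "shd u = 0"
    using u_nth[of 0] by (simp add: phi_iter_0 phi_iter_Suc phi_def)
  moreover have "u \<in> streams {..<d}"
  proof -
    have "u !! n < d" for n
      using set_phi_iter[OF assms, of "Suc n"] lenS[of n] u_nth[of n]
      by (metis lessThan_iff nth_mem subsetD)
    then show ?thesis by (auto simp: streams_iff_sset sset_range)
  qed
  ultimately show "\<exists>u. is_fixed_point d u" unfolding is_fixed_point_def by blast
next
  fix u v
  assume "is_fixed_point d u" "is_fixed_point d v"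
  then show "u = v"
    unfolding is_fixed_point_def
    by (metis stream_eqI fixed_prefix snth_of_prefix)
qed

lemma is_fixed_point_fixed_word: "d \<ge> 1 \<Longrightarrow> is_fixed_point d (fixed_word d)"
  unfolding fixed_word_def by (rule theI') (rule ex1_fixed_point)

end

theory Submission
  imports Defs
begin

text \<open>
  Every image of a letter contains exactly one \<open>0\<close>, at its beginning, so a word is desubstituted by
  cutting it in front of each \<open>0\<close>. Write \<open>D = d - 1\<close>. A bispecial factor other than the empty word
  and \<open>D\<close> is \<open>x \<phi>(v) 0 y\<close>, where each of \<open>x\<close>, \<open>y\<close> is empty or \<open>D\<close>, and the set of pairs \<open>(i, j)\<close>
  extending it on both sides is the image of the corresponding set for \<open>v\<close> under partial maps of the
  letters that fix \<open>D\<close>: the map \<open>i \<mapsto> min (i + 1) D\<close> if \<open>x\<close> (or \<open>y\<close>) is empty, and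
  \<open>D - 1 \<mapsto> 0\<close>, \<open>D \<mapsto> D\<close> otherwise. Starting from the empty word and \<open>D\<close>, only two shapes of
  extension sets (\<open>star_pattern\<close> and \<open>square_pattern\<close>) can arise, and both have bilateral order \<open>0\<close>.
\<close>

section \<open>Extension patterns and their cardinalities\<close>

definition star_pattern :: "nat \<Rightarrow> nat \<Rightarrow> (nat \<times> nat) set" where
  "star_pattern D k = insert (D, D) ({k} \<times> {k<..D} \<union> {k<..D} \<times> {k})"

definition square_pattern :: "nat \<Rightarrow> nat \<Rightarrow> nat \<Rightarrow> nat \<times> nat \<Rightarrow> (nat \<times> nat) set" where
  "square_pattern D l m e = {l, D} \<times> {m, D} - {e}"

definition tame :: "nat \<Rightarrow> (nat \<times> nat) set \<Rightarrow> bool" where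
  "tame D E \<longleftrightarrow> (\<exists>k<D. E = star_pattern D k) \<or>
    (\<exists>l<D. \<exists>m<D. \<exists>e \<in> {l, D} \<times> {m, D}. E = square_pattern D l m e)"

text \<open>Bispeciality read off from the pairs, phrased by witnesses so that it pulls back along
  letter maps.\<close>

definition thick :: "(nat \<times> nat) set \<Rightarrow> bool" where
  "thick E \<longleftrightarrow> (\<exists>a b a' b'. (a, b) \<in> E \<and> (a', b') \<in> E \<and> a \<noteq> a') \<and>
    (\<exists>a b a' b'. (a, b) \<in> E \<and> (a', b') \<in> E \<and> b \<noteq> b')"

lemma square_pattern_simps:
  assumes "l < D" "m < D"
  shows "square_pattern D l m (l, m) = {(l, D), (D, m), (D, D)}"
    "square_pattern D l m (l, D) = {(l, m), (D, m), (D, D)}"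
    "square_pattern D l m (D, m) = {(l, m), (l, D), (D, D)}"
    "square_pattern D l m (D, D) = {(l, m), (l, D), (D, m)}"
  using assms by (auto simp: square_pattern_def)

text \<open>This is the edge count of a tree, with \<open>E\<close> viewed as a bipartite graph
  between left and right letters. A star pattern is two stars, centred at the left and the right
  \<open>k\<close>, joined by the edge \<open>(D, D)\<close>; a square pattern is a 4-cycle with one
  edge removed.\<close>

lemma card_tame:
  assumes "tame D E"
  shows "card E + 1 = card (fst ` E) + card (snd ` E)"
  using assms unfolding tame_def
proof (elim disjE exE conjE bexE)
  fix k assume k: "k < D" and E: "E = star_pattern D k"
  have "fst ` E = {k..D}" "snd ` E = {k..D}"
    using k by (auto simp: E star_pattern_def image_Un)
  moreover have "card E = 1 + ((D - k) + (D - k))"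
  proof -
    have "card ({k} \<times> {k<..D} \<union> {k<..D} \<times> {k}) = (D - k) + (D - k)"
      by (subst card_Un_disjoint) (auto simp: card_cartesian_product)
    then show ?thesis
      using k by (auto simp: E star_pattern_def card_insert_if)
  qed
  ultimately show ?thesis using k by simp
next
  fix l m e
  assume lm: "l < D" "m < D" and e: "e \<in> {l, D} \<times> {m, D}"
    and E: "E = square_pattern D l m e"
  from e consider "e = (l, m)" | "e = (l, D)" | "e = (D, m)" | "e = (D, D)" by blast
  then have "fst ` E = {l, D} \<and> snd ` E = {m, D}"
    by cases (auto simp: E square_pattern_simps lm)
  moreover have "card E = card ({l, D} \<times> {m, D}) - 1"
    unfolding E square_pattern_def by (rule card_Diff_singleton) (use e in auto)
  ultimately show ?thesis using lm by (simp add: card_cartesian_product)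
qed

section \<open>The morphism and its language\<close>

context
  fixes D :: nat
  assumes D: "D \<ge> 2"
begin

definition img :: "nat list \<Rightarrow> nat list" where
  "img w = concat (map (phi (Suc D)) w)"

text \<open>Finite prefixes of the fixed point keep the combinatorics on lists;
  \<open>factors_fixed_word\<close> makes the link with the stream.\<close>

definition lang :: "nat list set" where
  "lang = {w. \<exists>n p q. phi_iter (Suc D) n = p @ w @ q}"

definition ext_pairs :: "nat list \<Rightarrow> (nat \<times> nat) set" where
  "ext_pairs w = {(i, j). i # w @ [j] \<in> lang}"

lemma phi_Suc: "phi (Suc D) i = (if i = D then [0, D, D] else [0, Suc i])"
  by (simp add: phi_def)

lemma img_simps [simp]:
  "img [] = []" "img (a # w) = phi (Suc D) a @ img w" "img (v @ w) = img v @ img w"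
  by (simp_all add: img_def)

lemma img_eq_Nil [simp]: "img w = [] \<longleftrightarrow> w = []"
  by (cases w) (auto simp: phi_Suc)

lemma img_eq_Cons: "img w = x # y \<Longrightarrow> x = 0"
  by (cases w) (auto simp: phi_Suc split: if_splits)

lemma phi_iter_Suc_img: "phi_iter (Suc D) (Suc n) = img (phi_iter (Suc D) n)"
  by (simp add: phi_iter_Suc img_def)

section \<open>Desubstitution\<close>

lemma phi_cut:
  assumes "phi (Suc D) a @ y = p @ 0 # r" "p \<noteq> []"
  shows "\<exists>p'. p = phi (Suc D) a @ p' \<and> y = p' @ 0 # r"
  using assms D
  by (cases p; cases "tl p"; cases "tl (tl p)") (auto simp: phi_Suc split: if_splits)

text \<open>Synchronization: \<open>0\<close> occurs only at the start of a block (the image of a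
  letter), so each \<open>0\<close> marks a cut. The induction peels off the blocks before
  it.\<close>

lemma img_cut:
  assumes "img x = p @ 0 # r"
  shows "\<exists>p' r'. x = p' @ r' \<and> img p' = p \<and> img r' = 0 # r"
  using assms
proof (induction x arbitrary: p)
  case Nil
  then show ?case by simp
next
  case (Cons a x)
  show ?case
  proof (cases "p = []")
    case True
    with Cons.prems show ?thesis by (intro exI[of _ "[]"] exI[of _ "a # x"]) simp
  next
    case False
    with Cons.prems phi_cut[of a "img x" p r] obtain p1
      where p1: "p = phi (Suc D) a @ p1" "img x = p1 @ 0 # r" by auto
    from Cons.IH[OF p1(2)] obtain p' r' where "x = p' @ r'" "img p' = p1" "img r' = 0 # r"
      by blast
    with p1 show ?thesis by (intro exI[of _ "a # p'"] exI[of _ r']) auto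
  qed
qed

text \<open>A block extends to the next \<open>0\<close> or to the end of the word. This separates
  \<open>[0, D]\<close> from \<open>[0, D, D]\<close>, the only two blocks of which one is a prefix
  of the other.\<close>

lemma img_inj: "img v = img w \<Longrightarrow> v = w"
proof (induction v arbitrary: w)
  case Nil
  then show ?case by (metis img_eq_Nil img_simps(1))
next
  case (Cons a v)
  then obtain b w' where w: "w = b # w'"
    by (metis img_eq_Nil list.distinct(1) neq_Nil_conv)
  have eq: "phi (Suc D) a @ img v = phi (Suc D) b @ img w'"
    using Cons.prems w by simp
  have "img v = [] \<or> hd (img v) = 0" "img w' = [] \<or> hd (img w') = 0"
    by (metis img_eq_Cons list.collapse)+
  then have "a = b"
    using eq D by (cases "img v"; cases "img w'") (simp_all add: phi_Suc split: if_splits)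
  with eq Cons.IH w show ?case by simp
qed

section \<open>Closure properties of the language\<close>

lemma lang_factor: "p @ w @ q \<in> lang \<Longrightarrow> w \<in> lang"
  unfolding lang_def by (smt (verit, best) append.assoc mem_Collect_eq)

lemma lang_letters:
  assumes "w \<in> lang"
  shows "set w \<subseteq> {..D}"
proof -
  obtain n p q where "phi_iter (Suc D) n = p @ w @ q"
    using assms by (auto simp: lang_def)
  with set_phi_iter[of "Suc D" n] show ?thesis by (auto simp: less_Suc_eq_le)
qed

lemma lang_extend_right:
  assumes "w \<in> lang"
  shows "\<exists>j. w @ [j] \<in> lang"
proof -
  obtain n p q where n: "phi_iter (Suc D) n = p @ w @ q"
    using assms by (auto simp: lang_def)
  obtain v where v: "phi_iter (Suc D) (Suc n) = phi_iter (Suc D) n @ v"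
    using phi_iter_extends_Suc by blast
  \<comment> \<open>Lengths at least double, so the next iterate is a proper extension and some
    letter follows \<open>w\<close>.\<close>
  have "length (phi_iter (Suc D) (Suc n)) \<ge> 2 * length (phi_iter (Suc D) n)"
    by (metis phi_iter_Suc length_concat_phi)
  with length_phi_iter[of n "Suc D"] v have "v \<noteq> []" by auto
  then obtain j t where "q @ v = j # t"
    by (metis append_is_Nil_conv neq_Nil_conv)
  then have "phi_iter (Suc D) (Suc n) = p @ (w @ [j]) @ t"
    using n v by simp
  then show ?thesis unfolding lang_def by blast
qed

text \<open>Supplies a left neighbour even for prefixes of the fixed point. The second
  \<open>0\<close> of \<open>[0, 1, 0, 2]\<close> is a later occurrence of the first iterate, and
  applying the morphism carries it to all others.\<close>

lemma phi_iter_occurs_later: "\<exists>m p q. p \<noteq> [] \<and> phi_iter (Suc D) m = p @ phi_iter (Suc D) n @ q"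
proof (induction n)
  case 0
  have "phi_iter (Suc D) (Suc (Suc 0)) = [0, 1] @ [0] @ [2]"
    using D by (simp add: phi_iter_Suc_img phi_iter_0 phi_Suc)
  then show ?case unfolding phi_iter_0 by blast
next
  case (Suc n)
  then obtain m p q where "p \<noteq> []" "phi_iter (Suc D) m = p @ phi_iter (Suc D) n @ q" by blast
  then have "img p \<noteq> [] \<and> phi_iter (Suc D) (Suc m) = img p @ phi_iter (Suc D) (Suc n) @ img q"
    by (simp add: phi_iter_Suc_img)
  then show ?case by blast
qed

lemma lang_extend_left:
  assumes "w \<in> lang"
  shows "\<exists>i. i # w \<in> lang"
proof -
  obtain n p q where n: "phi_iter (Suc D) n = p @ w @ q"
    using assms by (auto simp: lang_def)
  obtain m p' q' where m: "p' \<noteq> []" "phi_iter (Suc D) m = p' @ phi_iter (Suc D) n @ q'"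
    using phi_iter_occurs_later by blast
  from m(1) obtain t i where "p' @ p = t @ [i]"
    by (metis append_is_Nil_conv rev_exhaust)
  then have "phi_iter (Suc D) m = t @ (i # w) @ (q @ q')"
    using n m(2) by (metis append.assoc append_Cons append_Nil)
  then show ?thesis unfolding lang_def by blast
qed

text \<open>The final \<open>0\<close> starts the block of whichever letter follows
  \<open>w\<close>.\<close>

lemma img_lang:
  assumes "w \<in> lang"
  shows "img w @ [0] \<in> lang"
proof -
  obtain j where "w @ [j] \<in> lang" using lang_extend_right[OF assms] by blast
  then obtain n p q where "phi_iter (Suc D) n = p @ (w @ [j]) @ q"
    by (auto simp: lang_def)
  then have "phi_iter (Suc D) (Suc n) = img p @ (img w @ [0]) @ (tl (phi (Suc D) j) @ img q)"
    by (simp add: phi_iter_Suc_img phi_Suc)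
  then show ?thesis unfolding lang_def by blast
qed

lemma lang_desubst:
  assumes "w \<in> lang"
  shows "\<exists>x p q. x \<in> lang \<and> img x = p @ w @ q"
proof -
  obtain n p q where n: "phi_iter (Suc D) n = p @ w @ q"
    using assms by (auto simp: lang_def)
  \<comment> \<open>The iterate is a prefix of its own image, so \<open>w\<close> occurs in the
    image of the same iterate.\<close>
  obtain v where "phi_iter (Suc D) (Suc n) = phi_iter (Suc D) n @ v"
    using phi_iter_extends_Suc by blast
  with n have "img (phi_iter (Suc D) n) = p @ w @ (q @ v)"
    by (simp add: phi_iter_Suc_img)
  moreover have "phi_iter (Suc D) n \<in> lang"
    unfolding lang_def by (metis (mono_tags) append_Nil append_Nil2 mem_Collect_eq)
  ultimately show ?thesis by blast
qed

section \<open>Zero-free and short factors\<close>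

lemma zero_free_prefix:
  assumes "0 \<notin> set z" "phi (Suc D) a @ img r = 0 # z @ q"
  shows "\<exists>t. tl (phi (Suc D) a) = z @ t"
proof -
  have "tl (phi (Suc D) a) @ img r = z @ q"
    using assms(2) by (auto simp: phi_Suc split: if_splits)
  then consider us where "tl (phi (Suc D) a) = z @ us"
    | us where "z = tl (phi (Suc D) a) @ us" "img r = us @ q"
    by (auto simp: append_eq_append_conv2)
  then show ?thesis
  proof cases
    case 2
    then have "us = []"
      using assms(1) by (cases us) (auto dest: img_eq_Cons)
    with 2 show ?thesis by simp
  qed blast
qed

text \<open>Going left from \<open>z\<close> to the nearest \<open>0\<close> reaches the start of a
  block, and \<open>z\<close> must end before the next block starts.\<close>

lemma zero_free_factor:
  assumes "z \<in> lang" "0 \<notin> set z" "z \<noteq> []"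
  shows "\<exists>a s t. tl (phi (Suc D) a) = s @ z @ t"
proof -
  obtain x p q where x: "img x = p @ z @ q"
    using lang_desubst[OF assms(1)] by blast
  \<comment> \<open>The image begins with \<open>0\<close> and \<open>z\<close> does not, so
    \<open>p\<close> is nonempty and begins with \<open>0\<close>.\<close>
  have "0 \<in> set p"
  proof (cases p)
    case Nil
    with x assms(2,3) show ?thesis by (cases z) (auto dest: img_eq_Cons)
  next
    case (Cons b p')
    with x show ?thesis by (auto dest: img_eq_Cons)
  qed
  then obtain p1 p2 where p: "p = p1 @ 0 # p2" "0 \<notin> set p2"
    by (metis split_list_last)
  with x have "img x = p1 @ 0 # (p2 @ z) @ q" by simp
  from img_cut[OF this] obtain r where "img r = 0 # (p2 @ z) @ q" by blast
  moreover from this obtain a r' where "r = a # r'" by (cases r) auto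
  ultimately have "\<exists>t. tl (phi (Suc D) a) = (p2 @ z) @ t"
    using p(2) assms(2) by (intro zero_free_prefix[of "p2 @ z" a r' q]) auto
  then show ?thesis by auto
qed

lemma zero_free_cases:
  assumes "z \<in> lang" "0 \<notin> set z"
  shows "length z < 2 \<or> z = [D, D]"
proof (cases "z = []")
  case False
  then obtain a s t where "tl (phi (Suc D) a) = s @ z @ t"
    using zero_free_factor assms by blast
  with False show ?thesis
    by (auto simp: phi_Suc Cons_eq_append_conv append_eq_Cons_conv split: if_splits)
qed simp

lemma no_zero_zero: "[0, 0] \<notin> lang"
proof
  assume "[0, 0] \<in> lang"
  then obtain x p q where "img x = p @ [0, 0] @ q" using lang_desubst by blast
  then have "img x = p @ 0 # 0 # q" by simp
  from img_cut[OF this] obtain r where "img r = 0 # 0 # q" by blast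
  then show False using D by (cases r) (auto simp: phi_Suc split: if_splits)
qed

lemma letter_in_lang: "a \<le> D \<Longrightarrow> [a] \<in> lang"
proof (induction a)
  case 0
  have "phi_iter (Suc D) 0 = [] @ [0] @ []" by (simp add: phi_iter_0)
  then show ?case unfolding lang_def by blast
next
  case (Suc a)
  then have "[0] @ [Suc a] @ [0] \<in> lang"
    using img_lang[of "[a]"] by (simp add: phi_Suc)
  then show ?case by (rule lang_factor)
qed

lemma two_letters_nonzero: "[i, j] \<in> lang \<Longrightarrow> i \<noteq> 0 \<Longrightarrow> j \<noteq> 0 \<Longrightarrow> i = D \<and> j = D"
  using zero_free_cases[of "[i, j]"] by auto

lemma zero_letter_zero:
  assumes "0 < j" "j \<le> D"
  shows "[0, j, 0] \<in> lang"
  using assms img_lang[OF letter_in_lang[of "j - 1"]] by (cases j) (auto simp: phi_Suc)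

lemma zero_D_D_zero: "[0, D, D, 0] \<in> lang"
  using img_lang[OF letter_in_lang[of D]] by (auto simp: phi_Suc)

lemma D_D: "[D, D] \<in> lang"
  using zero_D_D_zero lang_factor[of "[0]" "[D, D]" "[0]"] by simp

section \<open>Extension sets of the two initial words\<close>

lemma ext_pairs_Nil: "ext_pairs [] = star_pattern D 0"
proof -
  have "[i, j] \<in> lang \<longleftrightarrow> (i, j) \<in> star_pattern D 0" for i j
  proof
    assume a: "[i, j] \<in> lang"
    then have "i \<le> D" "j \<le> D" using lang_letters by fastforce+
    moreover have "\<not> (i = 0 \<and> j = 0)" using a no_zero_zero by metis
    moreover have "i = 0 \<or> j = 0 \<or> i = D \<and> j = D" using a two_letters_nonzero by blast
    ultimately show "(i, j) \<in> star_pattern D 0"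
      by (cases "i = 0"; cases "j = 0") (auto simp: star_pattern_def)
  next
    assume "(i, j) \<in> star_pattern D 0"
    then show "[i, j] \<in> lang"
      using D_D zero_letter_zero[of j] zero_letter_zero[of i]
        lang_factor[of "[]" "[0, j]" "[0]"] lang_factor[of "[0]" "[i, 0]" "[]"]
      by (auto simp: star_pattern_def)
  qed
  then show ?thesis by (auto simp: ext_pairs_def)
qed

lemma ext_pairs_D: "ext_pairs [D] = square_pattern D 0 0 (D, D)"
proof -
  have "[i, D, j] \<in> lang \<longleftrightarrow> (i, j) \<in> square_pattern D 0 0 (D, D)" for i j
  proof
    assume a: "[i, D, j] \<in> lang"
    then have "[i, D] \<in> lang" "[D, j] \<in> lang"
      using lang_factor[of "[]" "[i, D]" "[j]"] lang_factor[of "[i]" "[D, j]" "[]"] by auto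
    then have "i = 0 \<or> i = D" "j = 0 \<or> j = D" using two_letters_nonzero D by fastforce+
    \<comment> \<open>This corner would give the zero-free factor \<open>[D, D, D]\<close>, longer
      than any block tail.\<close>
    moreover have "\<not> (i = D \<and> j = D)" using a D zero_free_cases[of "[D, D, D]"] by auto
    ultimately show "(i, j) \<in> square_pattern D 0 0 (D, D)" by (auto simp: square_pattern_def)
  next
    assume "(i, j) \<in> square_pattern D 0 0 (D, D)"
    then show "[i, D, j] \<in> lang"
      using zero_letter_zero[of D] D zero_D_D_zero
        lang_factor[of "[]" "[0, D, D]" "[0]"] lang_factor[of "[0]" "[D, D, 0]" "[]"]
      by (auto simp: square_pattern_def)
  qed
  then show ?thesis by (auto simp: ext_pairs_def)
qed

section \<open>Transfer of extension sets through the morphism\<close>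

definition pad :: "bool \<Rightarrow> nat list" where
  "pad c = (if c then [D] else [])"

text \<open>If \<open>a\<close> is next to \<open>v\<close>, then \<open>i\<close> is the letter
  next to the padding: on the left it precedes \<open>pad c\<close> at the end of the block of
  \<open>a\<close>, on the right it follows \<open>0 # pad c\<close>. Both readings agree, so one
  relation serves both sides.\<close>

definition letter_rel :: "bool \<Rightarrow> nat \<Rightarrow> nat \<Rightarrow> bool" where
  "letter_rel c a i \<longleftrightarrow> (if c then a = D - 1 \<and> i = 0 \<or> a = D \<and> i = D else i = min (Suc a) D)"

lemma letter_rel_left: "a \<le> D \<Longrightarrow> letter_rel c a i \<longleftrightarrow> (\<exists>p. phi (Suc D) a = p @ i # pad c)"
  using D by (auto simp: letter_rel_def pad_def phi_Suc Cons_eq_append_conv)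

text \<open>The extra \<open>[0]\<close> starts the following block; it is the letter
  \<open>j\<close> itself when \<open>c\<close> holds and \<open>b = D - 1\<close>.\<close>

lemma letter_rel_right:
  "b \<le> D \<Longrightarrow> letter_rel c b j \<longleftrightarrow> (\<exists>q. phi (Suc D) b @ [0] = 0 # pad c @ j # q)"
  using D by (auto simp: letter_rel_def pad_def phi_Suc)

lemma letter_rel_right_img:
  assumes "b \<le> D" "img (b # x) = 0 # pad c @ j # q"
  shows "letter_rel c b j"
proof -
  have "img x = [] \<or> hd (img x) = 0" by (metis img_eq_Cons list.collapse)
  then show ?thesis
    using assms D
    by (cases "img x") (auto simp: letter_rel_def pad_def phi_Suc split: if_splits)
qed

lemma letter_rel_left_img:
  assumes "a \<le> D" "img (x @ [a]) = p @ i # pad c"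
  shows "letter_rel c a i"
proof -
  have e: "img x @ phi (Suc D) a = p @ i # pad c" using assms(2) by simp
  \<comment> \<open>A block has at least two letters and \<open>i # pad c\<close> at most two, so
    this suffix fits into the last block.\<close>
  have len: "length (i # pad c) \<le> length (phi (Suc D) a)" by (simp add: phi_Suc pad_def)
  from e obtain us where "us @ phi (Suc D) a = i # pad c \<or> phi (Suc D) a = us @ i # pad c"
    by (auto simp: append_eq_append_conv2)
  with len obtain s where "phi (Suc D) a = s @ i # pad c"
    by (metis append_Nil append_eq_append_conv length_append le_add2 le_antisym)
  then show ?thesis using assms(1) letter_rel_left by blast
qed

text \<open>The first \<open>0\<close> after \<open>pad c\<close> and the \<open>0\<close> before
  \<open>pad e\<close> are block starts. Cutting there isolates \<open>img v\<close>, whose preimage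
  is \<open>v\<close> by injectivity; the blocks of the neighbours \<open>a\<close> and
  \<open>b\<close> then determine \<open>i\<close> and \<open>j\<close>.\<close>

lemma ext_pairs_img:
  "ext_pairs (pad c @ img v @ 0 # pad e) =
    {(i, j). \<exists>(a, b) \<in> ext_pairs v. letter_rel c a i \<and> letter_rel e b j}" (is "?L = ?R")
proof (intro equalityI subrelI)
  fix i j assume "(i, j) \<in> ?L"
  then have "i # pad c @ img v @ 0 # pad e @ [j] \<in> lang" by (simp add: ext_pairs_def)
  then obtain x p q where x: "x \<in> lang" "img x = p @ (i # pad c @ img v @ 0 # pad e @ [j]) @ q"
    using lang_desubst by blast
  \<comment> \<open>If \<open>v\<close> is empty, the leading \<open>0\<close> is the one displayed
    after \<open>img v\<close>.\<close>
  obtain y where y: "img v @ 0 # pad e @ [j] @ q = 0 # y"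
    by (cases "img v") (auto dest: img_eq_Cons)
  have "img x = (p @ i # pad c) @ 0 # y"
    using x(2) y by simp
  from img_cut[OF this] obtain x1 x2 where
    x12: "x = x1 @ x2" "img x1 = p @ i # pad c" "img x2 = 0 # y" by blast
  from x12(3) y have "img x2 = img v @ 0 # pad e @ j # q" by simp
  from img_cut[OF this] obtain v' x3 where
    x3: "x2 = v' @ x3" "img v' = img v" "img x3 = 0 # pad e @ j # q" by blast
  from x3(2) have v': "v' = v" by (rule img_inj)
  obtain x1' a where a: "x1 = x1' @ [a]"
    using x12(2) by (cases x1 rule: rev_cases) auto
  obtain b x3' where b: "x3 = b # x3'"
    using x3(3) by (cases x3) auto
  have "x1' @ (a # v @ [b]) @ x3' \<in> lang" using x(1) x12(1) x3(1) v' a b by simp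
  then have avb: "a # v @ [b] \<in> lang" by (rule lang_factor)
  then have "a \<le> D" "b \<le> D" using lang_letters by fastforce+
  then have "letter_rel c a i" "letter_rel e b j"
    using letter_rel_left_img x12(2) a letter_rel_right_img x3(3) b by blast+
  with avb show "(i, j) \<in> ?R" by (auto simp: ext_pairs_def)
next
  fix i j assume "(i, j) \<in> ?R"
  then obtain a b where avb: "a # v @ [b] \<in> lang" and r: "letter_rel c a i" "letter_rel e b j"
    by (auto simp: ext_pairs_def)
  then have "a \<le> D" "b \<le> D" using lang_letters by fastforce+
  then obtain p q where "phi (Suc D) a = p @ i # pad c" "phi (Suc D) b @ [0] = 0 # pad e @ j # q"
    using r letter_rel_left letter_rel_right by blast
  with img_lang[OF avb] have "p @ (i # (pad c @ img v @ 0 # pad e) @ [j]) @ q \<in> lang" by simp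
  then have "i # (pad c @ img v @ 0 # pad e) @ [j] \<in> lang" by (rule lang_factor)
  then show "(i, j) \<in> ?L" by (simp add: ext_pairs_def)
qed

section \<open>Preservation of the two patterns\<close>

lemma letter_rel_fun: "letter_rel c a i \<Longrightarrow> letter_rel c a i' \<Longrightarrow> i = i'"
  using D by (auto simp: letter_rel_def split: if_splits)

lemma letter_rel_D: "letter_rel c D i \<longleftrightarrow> i = D"
  using D by (auto simp: letter_rel_def)

lemma letter_rel_le: "letter_rel c a i \<Longrightarrow> i \<le> D"
  by (auto simp: letter_rel_def split: if_splits)

text \<open>The letter maps are functional, so distinct images come from distinct letters.\<close>

lemma thick_img:
  assumes "thick {(i, j). \<exists>(a, b) \<in> E. letter_rel c a i \<and> letter_rel e b j}"
  shows "thick E"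
proof -
  let ?F = "{(i, j). \<exists>(a, b) \<in> E. letter_rel c a i \<and> letter_rel e b j}"
  obtain i j i' j' where 1: "(i, j) \<in> ?F" "(i', j') \<in> ?F" "i \<noteq> i'"
    using assms unfolding thick_def by blast
  then obtain a b a' b' where "(a, b) \<in> E" "letter_rel c a i" "(a', b') \<in> E" "letter_rel c a' i'"
    by blast
  moreover from this 1(3) have "a \<noteq> a'" using letter_rel_fun by blast
  ultimately have "\<exists>a b a' b'. (a, b) \<in> E \<and> (a', b') \<in> E \<and> a \<noteq> a'" by blast
  moreover obtain i j i' j' where 2: "(i, j) \<in> ?F" "(i', j') \<in> ?F" "j \<noteq> j'"
    using assms unfolding thick_def by blast
  then obtain a b a' b' where "(a, b) \<in> E" "letter_rel e b j" "(a', b') \<in> E" "letter_rel e b' j'"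
    by blast
  moreover from this 2(3) have "b \<noteq> b'" using letter_rel_fun by blast
  ultimately show ?thesis unfolding thick_def by blast
qed

text \<open>Both letter maps fix \<open>D\<close>. If \<open>l\<close> or \<open>m\<close> had no
  image, or the image \<open>D\<close>, a projection of \<open>F\<close> would lie in
  \<open>{D}\<close>, against thickness. Otherwise the square is relabelled injectively together
  with its missing corner.\<close>

lemma tame_square_img:
  assumes lm: "l < D" "m < D" and e: "e \<in> {l, D} \<times> {m, D}"
    and F: "F = {(i, j). \<exists>(a, b) \<in> square_pattern D l m e. letter_rel c a i \<and> letter_rel c' b j}"
    and "thick F"
  shows "tame D F"
proof -
  obtain i1 j1 i2 j2 where 1: "(i1, j1) \<in> F" "(i2, j2) \<in> F" "i1 \<noteq> i2"
    using \<open>thick F\<close> unfolding thick_def by blast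
  obtain i3 j3 i4 j4 where 2: "(i3, j3) \<in> F" "(i4, j4) \<in> F" "j3 \<noteq> j4"
    using \<open>thick F\<close> unfolding thick_def by blast
  have "\<exists>i. letter_rel c l i \<and> i \<noteq> D"
    using 1 by (auto simp: F square_pattern_def letter_rel_D dest: letter_rel_fun)
  then obtain l' where l': "letter_rel c l l'" "l' < D"
    using letter_rel_le le_neq_implies_less by blast
  have "\<exists>j. letter_rel c' m j \<and> j \<noteq> D"
    using 2 by (auto simp: F square_pattern_def letter_rel_D dest: letter_rel_fun)
  then obtain m' where m': "letter_rel c' m m'" "m' < D"
    using letter_rel_le le_neq_implies_less by blast
  have l: "letter_rel c l i \<longleftrightarrow> i = l'" for i using l' letter_rel_fun by blast
  have m: "letter_rel c' m i \<longleftrightarrow> i = m'" for i using m' letter_rel_fun by blast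
  from e consider "e = (l, m)" | "e = (l, D)" | "e = (D, m)" | "e = (D, D)" by blast
  then have "\<exists>e' \<in> {l', D} \<times> {m', D}. F = square_pattern D l' m' e'"
  proof cases
    case 1
    then have "F = square_pattern D l' m' (l', m')"
      by (auto simp: F square_pattern_simps lm l' m' letter_rel_D l m)
    then show ?thesis by blast
  next
    case 2
    then have "F = square_pattern D l' m' (l', D)"
      by (auto simp: F square_pattern_simps lm l' m' letter_rel_D l m)
    then show ?thesis by blast
  next
    case 3
    then have "F = square_pattern D l' m' (D, m')"
      by (auto simp: F square_pattern_simps lm l' m' letter_rel_D l m)
    then show ?thesis by blast
  next
    case 4
    then have "F = square_pattern D l' m' (D, D)"
      by (auto simp: F square_pattern_simps lm l' m' letter_rel_D l m)
    then show ?thesis by blast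
  qed
  then show ?thesis
    unfolding tame_def using l'(2) m'(2) by blast
qed

text \<open>Moves the last star to the square case: its centre \<open>D - 1\<close> goes to
  \<open>D\<close> without padding and to \<open>0\<close> with it, unlike the smaller
  centres.\<close>

lemma star_pattern_last: "star_pattern D (D - 1) = square_pattern D (D - 1) (D - 1) (D - 1, D - 1)"
  using D by (auto simp: star_pattern_def square_pattern_def)

text \<open>Without padding, letters move up by one, \<open>D - 1\<close> and \<open>D\<close>
  merging into \<open>D\<close>, and the centre becomes \<open>Suc k\<close>. On a padded side only
  \<open>D - 1\<close> and \<open>D\<close> survive: one padding leaves three corners of a square,
  two leave at most \<open>(D, D)\<close>.\<close>

lemma tame_star_img:
  assumes k: "k < D - 1"
    and F: "F = {(i, j). \<exists>(a, b) \<in> star_pattern D k. letter_rel c a i \<and> letter_rel c' b j}"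
    and "thick F"
  shows "tame D F"
proof (cases c; cases c')
  assume "\<not> c" "\<not> c'"
  have "F = star_pattern D (Suc k)"
  proof (intro equalityI subrelI)
    fix i j assume "(i, j) \<in> F"
    then obtain a b where "(a, b) \<in> star_pattern D k" and ij: "i = min (Suc a) D" "j = min (Suc b) D"
      using \<open>\<not> c\<close> \<open>\<not> c'\<close> by (auto simp: F letter_rel_def)
    then consider "a = D" "b = D" | "a = k" "k < b" | "b = k" "k < a"
      by (auto simp: star_pattern_def)
    then show "(i, j) \<in> star_pattern D (Suc k)"
    proof cases
      case 1
      then show ?thesis using ij by (simp add: star_pattern_def)
    next
      case 2
      then have "i = Suc k" "Suc k < j" "j \<le> D" using ij k by auto
      then show ?thesis by (simp add: star_pattern_def)
    next
      case 3
      then have "j = Suc k" "Suc k < i" "i \<le> D" using ij k by auto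
      then show ?thesis by (simp add: star_pattern_def)
    qed
  next
    fix i j assume "(i, j) \<in> star_pattern D (Suc k)"
    then consider "i = D" "j = D" | "i = Suc k" "Suc k < j" "j \<le> D" | "j = Suc k" "Suc k < i" "i \<le> D"
      by (auto simp: star_pattern_def)
    then show "(i, j) \<in> F"
    proof cases
      case 1
      then show ?thesis using letter_rel_D by (auto simp: F star_pattern_def)
    next
      case 2
      \<comment> \<open>For \<open>j = D\<close> the chosen preimage is \<open>D - 1\<close>, still
        above \<open>k\<close>.\<close>
      then have "(k, j - 1) \<in> star_pattern D k" "letter_rel c k i" "letter_rel c' (j - 1) j"
        using k \<open>\<not> c\<close> \<open>\<not> c'\<close> by (auto simp: letter_rel_def star_pattern_def)
      then show ?thesis unfolding F by blast
    next
      case 3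
      then have "(i - 1, k) \<in> star_pattern D k" "letter_rel c (i - 1) i" "letter_rel c' k j"
        using k \<open>\<not> c\<close> \<open>\<not> c'\<close> by (auto simp: letter_rel_def star_pattern_def)
      then show ?thesis unfolding F by blast
    qed
  qed
  moreover have "Suc k < D" using k by simp
  ultimately show ?thesis unfolding tame_def by blast
next
  assume "c" "\<not> c'"
  then have "F \<subseteq> {(0, Suc k), (D, Suc k), (D, D)}"
    using k by (auto simp: F letter_rel_def star_pattern_def)
  moreover have "(D - 1, k) \<in> star_pattern D k" "(D, k) \<in> star_pattern D k" "(D, D) \<in> star_pattern D k"
    "letter_rel c (D - 1) 0" "letter_rel c D D" "letter_rel c' k (Suc k)" "letter_rel c' D D"
    using k \<open>c\<close> \<open>\<not> c'\<close> by (auto simp: letter_rel_def star_pattern_def)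
  then have "{(0, Suc k), (D, Suc k), (D, D)} \<subseteq> F" unfolding F by blast
  \<comment> \<open>The corner \<open>(0, D)\<close> would need a pair \<open>(D - 1, b)\<close>
    with \<open>b\<close> equal to \<open>D - 1\<close> or \<open>D\<close>, and a star centred at
    \<open>k < D - 1\<close> has none.\<close>
  ultimately have "F = square_pattern D 0 (Suc k) (0, D)"
    using k by (simp add: square_pattern_simps)
  moreover have "0 < D" "Suc k < D" using k by simp_all
  ultimately show ?thesis unfolding tame_def by blast
next
  assume "\<not> c" "c'"
  then have "F \<subseteq> {(Suc k, 0), (Suc k, D), (D, D)}"
    using k by (auto simp: F letter_rel_def star_pattern_def)
  moreover have "(k, D - 1) \<in> star_pattern D k" "(k, D) \<in> star_pattern D k" "(D, D) \<in> star_pattern D k"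
    "letter_rel c' (D - 1) 0" "letter_rel c' D D" "letter_rel c k (Suc k)" "letter_rel c D D"
    using k \<open>\<not> c\<close> \<open>c'\<close> by (auto simp: letter_rel_def star_pattern_def)
  then have "{(Suc k, 0), (Suc k, D), (D, D)} \<subseteq> F" unfolding F by blast
  ultimately have "F = square_pattern D (Suc k) 0 (D, 0)"
    using k by (simp add: square_pattern_simps)
  moreover have "0 < D" "Suc k < D" using k by simp_all
  ultimately show ?thesis unfolding tame_def by blast
next
  assume "c" "c'"
  then have "F \<subseteq> {(D, D)}"
    using k by (auto simp: F letter_rel_def star_pattern_def)
  with \<open>thick F\<close> show ?thesis unfolding thick_def by blast
qed

lemma tame_img:
  assumes "tame D E"
    and F: "F = {(i, j). \<exists>(a, b) \<in> E. letter_rel c a i \<and> letter_rel c' b j}"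
    and "thick F"
  shows "tame D F"
proof -
  from assms(1) consider k where "k < D" "E = star_pattern D k"
    | l m e where "l < D" "m < D" "e \<in> {l, D} \<times> {m, D}" "E = square_pattern D l m e"
    unfolding tame_def by blast
  then show ?thesis
  proof cases
    case (1 k)
    show ?thesis
    proof (cases "k = D - 1")
      case True
      with 1 have "E = square_pattern D (D - 1) (D - 1) (D - 1, D - 1)"
        using star_pattern_last by simp
      then show ?thesis
        using tame_square_img[of "D - 1" "D - 1" "(D - 1, D - 1)" F c c'] F \<open>thick F\<close> D by simp
    next
      case False
      then show ?thesis using tame_star_img[of k F c c'] 1 F \<open>thick F\<close> by simp
    qed
  next
    case (2 l m e)
    then show ?thesis using tame_square_img[of l m e F c c'] F \<open>thick F\<close> by simp
  qed
qed

section \<open>Shape of the bispecial factors\<close>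

lemma thick_left_pad:
  assumes "thick (ext_pairs (w1 @ w2))" "0 \<notin> set w1"
  shows "\<exists>c. w1 = pad c"
proof -
  \<comment> \<open>Of two distinct left letters one is nonzero, which makes \<open>i # w1\<close> a
    zero-free factor.\<close>
  obtain i j where ij: "i \<noteq> 0" "i # (w1 @ w2) @ [j] \<in> lang"
    using assms(1) unfolding thick_def ext_pairs_def by (metis case_prodD mem_Collect_eq)
  then have "i # w1 \<in> lang" using lang_factor[of "[]" "i # w1" "w2 @ [j]"] by simp
  with zero_free_cases[of "i # w1"] ij(1) assms(2) have "w1 = [] \<or> w1 = [D]" by auto
  then show ?thesis by (metis pad_def)
qed

lemma thick_right_pad:
  assumes "thick (ext_pairs (w1 @ w2))" "0 \<notin> set w2"
  shows "\<exists>c. w2 = pad c"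
proof -
  obtain i j where ij: "j \<noteq> 0" "i # (w1 @ w2) @ [j] \<in> lang"
    using assms(1) unfolding thick_def ext_pairs_def by (metis case_prodD mem_Collect_eq)
  then have "w2 @ [j] \<in> lang" using lang_factor[of "i # w1" "w2 @ [j]" "[]"] by simp
  with zero_free_cases[of "w2 @ [j]"] ij(1) assms(2) have "w2 = [] \<or> w2 = [D]"
    by (auto simp: append_eq_Cons_conv)
  then show ?thesis by (metis pad_def)
qed

text \<open>Cut \<open>w\<close> at its first and last \<open>0\<close>. The zero-free ends are
  paddings; the stretch from the first \<open>0\<close> up to the last is an image, as both are
  block starts.\<close>

lemma thick_decompose:
  assumes t: "thick (ext_pairs w)" and w: "w \<noteq> []" "w \<noteq> [D]"
  shows "\<exists>c v e. w = pad c @ img v @ 0 # pad e"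
proof -
  have "0 \<in> set w"
    using thick_left_pad[of w "[]"] t w by (metis append_Nil2 pad_def)
  then obtain w1 w2 where w12: "w = w1 @ 0 # w2" "0 \<notin> set w1"
    by (metis split_list_first)
  then obtain c where c: "w1 = pad c" using thick_left_pad t by blast
  \<comment> \<open>The search includes the first \<open>0\<close> itself; if it is the only one,
    \<open>x\<close> is empty.\<close>
  obtain x w4 where x: "0 # w2 = x @ 0 # w4" "0 \<notin> set w4"
    by (metis split_list_last list.set_intros(1))
  have "w = (w1 @ x @ [0]) @ w4" using w12 x by simp
  then obtain e where e: "w4 = pad e" using thick_right_pad t x(2) by metis
  obtain i j where "i # w @ [j] \<in> lang"
    using t unfolding thick_def ext_pairs_def by blast
  then obtain y p q where "img y = p @ (i # w @ [j]) @ q"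
    using lang_desubst by blast
  then have "img y = (p @ i # w1) @ 0 # w2 @ [j] @ q" using w12 by simp
  from img_cut[OF this] obtain y2 where "img y2 = 0 # w2 @ [j] @ q" by blast
  then have "img y2 = x @ 0 # w4 @ [j] @ q" using x by (metis append.assoc append_Cons)
  from img_cut[OF this] obtain v where "img v = x" by blast
  then show ?thesis using w12 x(1) c e by auto
qed

text \<open>Thickness descends to the shorter word \<open>v\<close>, and tameness comes back up
  through the letter maps.\<close>

lemma thick_imp_tame: "thick (ext_pairs w) \<Longrightarrow> tame D (ext_pairs w)"
proof (induction "length w" arbitrary: w rule: less_induct)
  case less
  consider "w = []" | "w = [D]" | "w \<noteq> []" "w \<noteq> [D]" by blast
  then show ?case
  proof cases
    case 1
    then show ?thesis using ext_pairs_Nil D unfolding tame_def by (intro disjI1 exI[of _ 0]) simp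
  next
    case 2
    then have "ext_pairs w = square_pattern D 0 0 (D, D)" using ext_pairs_D by simp
    moreover have "0 < D" "(D, D) \<in> {0, D} \<times> {0, D}" using D by simp_all
    ultimately show ?thesis unfolding tame_def by blast
  next
    case 3
    then obtain c v e where w: "w = pad c @ img v @ 0 # pad e"
      using thick_decompose less.prems by blast
    have "length v < length w"
      using length_concat_phi[of v "Suc D"] by (simp add: w img_def)
    moreover have "thick (ext_pairs v)"
      using less.prems unfolding w ext_pairs_img by (rule thick_img)
    ultimately have "tame D (ext_pairs v)" using less.hyps by blast
    then show ?thesis
      by (rule tame_img[OF _ _ less.prems]) (simp only: w ext_pairs_img)
  qed
qed

section \<open>Return to the infinite word\<close>

lemma factors_fixed_word: "factors (fixed_word (Suc D)) = lang"
proof (intro equalityI subsetI)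
  have fp: "\<exists>v. fixed_word (Suc D) = phi_iter (Suc D) n @- v" for n
    using is_fixed_point_fixed_word[of "Suc D"] fixed_prefix unfolding is_fixed_point_def by auto
  {
    fix w assume "w \<in> lang"
    then obtain n p q where "phi_iter (Suc D) n = p @ w @ q" by (auto simp: lang_def)
    with fp[of n] show "w \<in> factors (fixed_word (Suc D))"
      unfolding factors_def by auto
  next
    fix w assume "w \<in> factors (fixed_word (Suc D))"
    then obtain p v where u: "fixed_word (Suc D) = (p @ w) @- v"
      by (auto simp: factors_def)
    \<comment> \<open>\<open>n\<close> is both a length and an iteration count: the
      \<open>n\<close>-th iterate has more than \<open>n\<close> letters and so covers
      \<open>p @ w\<close>.\<close>
    define n where "n = length (p @ w)"
    obtain v' where v': "fixed_word (Suc D) = phi_iter (Suc D) n @- v'" using fp by blast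
    have "n \<le> length (phi_iter (Suc D) n)" using length_phi_iter[of n "Suc D"] by simp
    then have "take n (phi_iter (Suc D) n) = stake n (fixed_word (Suc D))"
      by (simp add: v' stake_shift)
    also have "\<dots> = p @ w" by (simp add: u n_def stake_shift)
    finally have "phi_iter (Suc D) n = p @ w @ drop n (phi_iter (Suc D) n)"
      by (metis append.assoc append_take_drop_id)
    then show "w \<in> lang" unfolding lang_def by blast
  }
qed

text \<open>Every factor can be prolonged to the right, so each left extension is the first
  coordinate of some pair.\<close>

lemma card_Lext: "card (Lext {..<Suc D} (fixed_word (Suc D)) w) = card (fst ` ext_pairs w)"
proof -
  have "Lext {..<Suc D} (fixed_word (Suc D)) w = (\<lambda>i. i # w) ` fst ` ext_pairs w"
  proof (intro equalityI subsetI)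
    fix z assume "z \<in> Lext {..<Suc D} (fixed_word (Suc D)) w"
    then obtain i where i: "z = i # w" "i # w \<in> lang" by (auto simp: Lext_def factors_fixed_word)
    then obtain j where "(i, j) \<in> ext_pairs w"
      using lang_extend_right[of "i # w"] by (auto simp: ext_pairs_def)
    with i show "z \<in> (\<lambda>i. i # w) ` fst ` ext_pairs w" by force
  next
    fix z assume "z \<in> (\<lambda>i. i # w) ` fst ` ext_pairs w"
    then obtain i j where z: "z = i # w" and ij: "i # w @ [j] \<in> lang" by (auto simp: ext_pairs_def)
    have "i # w \<in> lang" using ij lang_factor[of "[]" "i # w" "[j]"] by simp
    moreover from this have "i \<le> D" using lang_letters by fastforce
    ultimately show "z \<in> Lext {..<Suc D} (fixed_word (Suc D)) w"
      using z by (auto simp: Lext_def factors_fixed_word)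
  qed
  then show ?thesis by (simp add: card_image inj_on_def)
qed

lemma card_Rext: "card (Rext {..<Suc D} (fixed_word (Suc D)) w) = card (snd ` ext_pairs w)"
proof -
  have "Rext {..<Suc D} (fixed_word (Suc D)) w = (\<lambda>j. w @ [j]) ` snd ` ext_pairs w"
  proof (intro equalityI subsetI)
    fix z assume "z \<in> Rext {..<Suc D} (fixed_word (Suc D)) w"
    then obtain j where j: "z = w @ [j]" "w @ [j] \<in> lang" by (auto simp: Rext_def factors_fixed_word)
    then obtain i where "(i, j) \<in> ext_pairs w"
      using lang_extend_left[of "w @ [j]"] by (auto simp: ext_pairs_def)
    with j show "z \<in> (\<lambda>j. w @ [j]) ` snd ` ext_pairs w" by force
  next
    fix z assume "z \<in> (\<lambda>j. w @ [j]) ` snd ` ext_pairs w"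
    then obtain i j where z: "z = w @ [j]" and ij: "i # w @ [j] \<in> lang" by (auto simp: ext_pairs_def)
    have "w @ [j] \<in> lang" using ij lang_factor[of "[i]" "w @ [j]" "[]"] by simp
    moreover from this have "j \<le> D" using lang_letters by fastforce
    ultimately show "z \<in> Rext {..<Suc D} (fixed_word (Suc D)) w"
      using z by (auto simp: Rext_def factors_fixed_word)
  qed
  then show ?thesis by (simp add: card_image inj_on_def)
qed

lemma card_Bext: "card (Bext {..<Suc D} (fixed_word (Suc D)) w) = card (ext_pairs w)"
proof -
  have "i \<le> D \<and> j \<le> D" if "i # w @ [j] \<in> lang" for i j
    using lang_letters[OF that] by auto
  then have "Bext {..<Suc D} (fixed_word (Suc D)) w = (\<lambda>(i, j). i # w @ [j]) ` ext_pairs w"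
    by (fastforce simp: Bext_def factors_fixed_word ext_pairs_def)
  then show ?thesis by (simp add: card_image inj_on_def case_prod_unfold prod_eq_iff)
qed

lemma thick_if_card:
  assumes "card (fst ` E) \<ge> 2" "card (snd ` E) \<ge> 2"
  shows "thick E"
proof -
  have "\<exists>x\<in>A. \<exists>y\<in>A. x \<noteq> y" if "card A \<ge> 2" for A :: "nat set"
  proof (rule ccontr)
    assume "\<not> ?thesis"
    \<comment> \<open>An infinite set has \<open>card\<close> equal to \<open>0\<close>, so the
      bound forces finiteness.\<close>
    moreover have "finite A" using that card.infinite by fastforce
    ultimately have "card A \<le> Suc 0" by (auto simp: card_le_Suc0_iff_eq)
    with that show False by simp
  qed
  from this[OF assms(1)] this[OF assms(2)] show ?thesis
    unfolding thick_def by force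
qed

lemma bispecial_imp_ordinary:
  assumes "bispecial {..<Suc D} (fixed_word (Suc D)) w"
  shows "ordinary {..<Suc D} (fixed_word (Suc D)) w"
proof -
  have "thick (ext_pairs w)"
    using assms thick_if_card
    by (simp add: bispecial_def left_special_def right_special_def card_Lext card_Rext)
  then have "card (ext_pairs w) + 1 = card (fst ` ext_pairs w) + card (snd ` ext_pairs w)"
    using thick_imp_tame card_tame by blast
  then show ?thesis
    unfolding ordinary_def bilateral_order_def card_Lext card_Rext card_Bext by linarith
qed

end

theorem theorem12:
  fixes d :: nat and w :: "nat list"
  assumes "d \<ge> 3"
    and "bispecial {..<d} (fixed_word d) w"
  shows "ordinary {..<d} (fixed_word d) w"
  using assms bispecial_imp_ordinary[of "d - 1" w] by simp

end
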